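(* For every integer $m\geq 1$, \[\psi_{sq}(P_{m}\circ K_{1})=\beta_{2}(P_{m}\circ K_{1})=m+\left\lceil\frac{m}{2}\right\rceil .\]
   Context: All graphs are finite and simple (undirected, no loops, no multiple edges). For a graph $G=(V,E)$ and $v\in V$, $N_G[v]=\{v\}\cup\{u\in V: uv\in E\}$ is the closed neighborhood of $v$. A sub-quorum coloring of $G$ is an onto partial function $f:V\rightarrow\{1,2,\ldots,\ell\}$ such that for every vertex $v\in V$, if $f(v)$ is defined, then at least half of the vertices of $N_G[v]$ at which $f$ is defined have the same color (value of $f$) as $v$. The sub-quorum coloring number $\psi_{sq}(G)$ is the maximum value of $\ell$ over all sub-quorum colorings of $G$. A set $S\subseteq V$ is a $2$-independent set of $G$ if every vertex of $S$ has at most one neighbor in $S$; the $2$-independence number $\beta_2(G)$ is the maximum cardinality of a $2$-independent set of $G$. $P_m$ is the path on $m$ vertices. The corona $P_m\circ K_1$ (the complete simple caterpillar) is the graph on $2m$ vertices obtained from $P_m$ by appending one new leaf to each vertex of $P_m$. *)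

theory Defs
  imports Complex_Main "Graph_Theory.Pair_Digraph"
begin

text \<open>Finite simple graphs are the symmetric pair digraphs of \<^locale>\<open>pair_graph\<close>: an edge
  $uv$ is the pair of arcs $(u,v)$ and $(v,u)$.\<close>

definition closed_nbhd :: "'a pair_pre_digraph \<Rightarrow> 'a \<Rightarrow> 'a set" where
  "closed_nbhd G v = insert v {u \<in> pverts G. (u, v) \<in> parcs G}"

text \<open>A partial function on the vertices is a map whose domain lies in the vertex set. The
  condition ``at least half'' is stated without division.\<close>

definition sub_quorum_coloring :: "'a pair_pre_digraph \<Rightarrow> nat \<Rightarrow> ('a \<rightharpoonup> nat) \<Rightarrow> bool" where
  "sub_quorum_coloring G l f \<longleftrightarrow>
     dom f \<subseteq> pverts G \<and> ran f = {1..l} \<and>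
     (\<forall>v \<in> dom f. card {u \<in> closed_nbhd G v. u \<in> dom f}
                   \<le> 2 * card {u \<in> closed_nbhd G v. u \<in> dom f \<and> f u = f v})"

definition sub_quorum_number :: "'a pair_pre_digraph \<Rightarrow> nat" where
  "sub_quorum_number G = Max {l. \<exists>f. sub_quorum_coloring G l f}"

definition two_independent :: "'a pair_pre_digraph \<Rightarrow> 'a set \<Rightarrow> bool" where
  "two_independent G S \<longleftrightarrow>
     S \<subseteq> pverts G \<and> (\<forall>v \<in> S. card {u \<in> S. (u, v) \<in> parcs G} \<le> 1)"

definition two_independence_number :: "'a pair_pre_digraph \<Rightarrow> nat" where
  "two_independence_number G = Max {card S | S. two_independent G S}"

definition path_graph :: "nat \<Rightarrow> nat pair_pre_digraph" where
  "path_graph m =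
     \<lparr> pverts = {..<m},
       parcs = {(i, j). i < m \<and> j < m \<and> (j = Suc i \<or> i = Suc j)} \<rparr>"

text \<open>In the corona with $K_1$, \<^term>\<open>Inl v\<close> is the original vertex \<^term>\<open>v\<close> and
  \<^term>\<open>Inr v\<close> is the leaf attached to it.\<close>

definition corona_K1 :: "'a pair_pre_digraph \<Rightarrow> ('a + 'a) pair_pre_digraph" where
  "corona_K1 G =
     \<lparr> pverts = Inl ` pverts G \<union> Inr ` pverts G,
       parcs = {(Inl u, Inl v) | u v. (u, v) \<in> parcs G}
             \<union> {(Inl v, Inr v) | v. v \<in> pverts G}
             \<union> {(Inr v, Inl v) | v. v \<in> pverts G} \<rparr>"

lemma pair_graph_path_graph: "pair_graph (path_graph m)"
proof -
  have "parcs (path_graph m) \<subseteq> {..<m} \<times> {..<m}"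
    by (auto simp: path_graph_def)
  then have "finite (parcs (path_graph m))"
    by (rule finite_subset) simp
  then show ?thesis
    by unfold_locales
      (auto simp: path_graph_def symmetric_def sym_def)
qed

lemma pair_graph_corona_K1:
  assumes "pair_graph G"
  shows "pair_graph (corona_K1 G)"
proof -
  interpret pair_graph G by fact
  have s: "(v, u) \<in> parcs G" if "(u, v) \<in> parcs G" for u v
    using that pair_sym_arcs by (auto simp: symmetric_def sym_def)
  have i: "u \<in> pverts G" "v \<in> pverts G" "u \<noteq> v" if "(u, v) \<in> parcs G" for u v
    using that in_arcsD1 in_arcsD2 pair_no_loops[of "(u, v)"] by auto
  have "parcs (corona_K1 G) \<subseteq> pverts (corona_K1 G) \<times> pverts (corona_K1 G)"
    by (auto simp: corona_K1_def i)
  then have "finite (parcs (corona_K1 G))"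
    by (rule finite_subset) (simp add: corona_K1_def)
  moreover have "sym (parcs (corona_K1 G))"
    by (rule symI) (auto simp: corona_K1_def dest: s)
  moreover have "u \<in> pverts (corona_K1 G) \<and> v \<in> pverts (corona_K1 G) \<and> u \<noteq> v"
    if "(u, v) \<in> parcs (corona_K1 G)" for u v
    using that by (auto simp: corona_K1_def dest: i)
  moreover have "finite (pverts (corona_K1 G))"
    by (simp add: corona_K1_def)
  ultimately show ?thesis
    by unfold_locales (auto simp: symmetric_def)
qed

text \<open>The maxima above are taken over finite nonempty sets.\<close>

lemma finite_sub_quorum_sizes:
  assumes "finite (pverts G)"
  shows "finite {l. \<exists>f. sub_quorum_coloring G l f}"
proof (rule finite_subset)
  show "{l. \<exists>f. sub_quorum_coloring G l f} \<subseteq> {..card (pverts G)}"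
  proof clarsimp
    fix l f assume f: "sub_quorum_coloring G l f"
    then have "finite (dom f)" and "card (dom f) \<le> card (pverts G)"
      using assms by (auto simp: sub_quorum_coloring_def intro: finite_subset card_mono)
    moreover have "{1..l} \<subseteq> (\<lambda>x. the (f x)) ` dom f"
    proof
      fix c assume "c \<in> {1..l}"
      then have "c \<in> ran f" using f unfolding sub_quorum_coloring_def by blast
      then obtain x where "f x = Some c" unfolding ran_def by blast
      then show "c \<in> (\<lambda>x. the (f x)) ` dom f"
        by (intro image_eqI[of _ _ x]) auto
    qed
    then have "card {1..l} \<le> card (dom f)"
      using \<open>finite (dom f)\<close> by (rule surj_card_le[rotated])
    ultimately show "l \<le> card (pverts G)" by simp
  qed
qed simp

lemma sub_quorum_sizes_nonempty: "{l. \<exists>f. sub_quorum_coloring G l f} \<noteq> {}"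
proof -
  have "sub_quorum_coloring G 0 Map.empty" by (simp add: sub_quorum_coloring_def)
  then show ?thesis by blast
qed

lemma finite_two_independent_sizes:
  assumes "finite (pverts G)"
  shows "finite {card S | S. two_independent G S}"
proof -
  have "{card S | S. two_independent G S} \<subseteq> card ` Pow (pverts G)"
    by (auto simp: two_independent_def)
  then show ?thesis using assms by (simp add: finite_subset)
qed

lemma two_independent_sizes_nonempty: "{card S | S. two_independent G S} \<noteq> {}"
proof -
  have "two_independent G {}" by (simp add: two_independent_def)
  then show ?thesis by blast
qed

end

theory Submission
  imports Defs
begin

text \<open>Giving all vertices of a 2-independent set different colors yields a sub-quorum coloring,
  and the leaves together with every other path vertex form a 2-independent set. For the upper
  bound, count each color at the last column (path vertex with its leaf) in which it occurs. If two
  consecutive columns were to contribute four colors, then in the closed neighborhood of the second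
  path vertex that vertex alone would have its color, against at least three colored vertices.\<close>

lemma two_independent_imp_sub_quorum_coloring:
  assumes fin: "finite (pverts G)" and S: "two_independent G S"
  shows "\<exists>f. sub_quorum_coloring G (card S) f"
proof -
  have sub: "S \<subseteq> pverts G" using S by (simp add: two_independent_def)
  then have finS: "finite S" using fin finite_subset by blast
  obtain g where g: "bij_betw g S {1..card S}"
    using finite_same_card_bij[of S "{1..card S}"] finS by auto
  define f where "f = (\<lambda>x. if x \<in> S then Some (g x) else None)"
  have dom: "dom f = S" by (auto simp: f_def split: if_splits)
  have "ran f = g ` S" by (auto simp: f_def ran_def)
  then have ran: "ran f = {1..card S}" using g by (simp add: bij_betw_def)
  \<comment> \<open>Inside \<open>S\<close>, the closed neighborhood of \<open>v\<close> consists of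
    \<open>v\<close> and at most one neighbor, so \<open>v\<close> alone already makes up half of
    it.\<close>
  have "card {u \<in> closed_nbhd G v. u \<in> S} \<le> 2 * card {u \<in> closed_nbhd G v. u \<in> S \<and> f u = f v}"
    if v: "v \<in> S" for v
  proof -
    have "{u \<in> closed_nbhd G v. u \<in> S} = insert v {u \<in> S. (u, v) \<in> parcs G}"
      using v sub by (auto simp: closed_nbhd_def)
    moreover have "card {u \<in> S. (u, v) \<in> parcs G} \<le> 1"
      using S v by (simp add: two_independent_def)
    ultimately have "card {u \<in> closed_nbhd G v. u \<in> S} \<le> 2"
      using card_insert_le_m1[of 2 "{u \<in> S. (u, v) \<in> parcs G}" v] by simp
    moreover have "card {v} \<le> card {u \<in> closed_nbhd G v. u \<in> S \<and> f u = f v}"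
      using v finS by (intro card_mono) (auto simp: closed_nbhd_def)
    ultimately show ?thesis by simp
  qed
  then show ?thesis
    using dom ran sub by (intro exI[of _ f]) (simp add: sub_quorum_coloring_def)
qed

lemma two_independence_number_le_sub_quorum_number:
  assumes "finite (pverts G)"
  shows "two_independence_number G \<le> sub_quorum_number G"
  unfolding two_independence_number_def sub_quorum_number_def
  using assms two_independent_imp_sub_quorum_coloring[OF assms]
  by (intro Max_mono finite_sub_quorum_sizes two_independent_sizes_nonempty) auto

lemma card_subset_singleton_le: "A \<subseteq> {x} \<Longrightarrow> card A \<le> 1"
  using card_mono[of "{x}" A] by simp

lemma finite_pverts_corona_path: "finite (pverts (corona_K1 (path_graph m)))"
  by (simp add: corona_K1_def path_graph_def)

lemma two_independence_number_corona_path_ge: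
  "m + (m + 1) div 2 \<le> two_independence_number (corona_K1 (path_graph m))"
proof -
  let ?G = "corona_K1 (path_graph m)"
  \<comment> \<open>The even path vertices: pairwise nonadjacent, and numerous enough to give the
    rounded-up half of \<open>m\<close>.\<close>
  define E where "E = (\<lambda>j. 2 * j) ` {..<(m + 1) div 2}"
  define S where "S = Inr ` {..<m} \<union> Inl ` E"
  have E: "i < m \<and> even i" if "i \<in> E" for i
    using that by (auto simp: E_def)
  have "card E = (m + 1) div 2"
    unfolding E_def by (subst card_image) (auto simp: inj_on_def)
  then have card: "card S = m + (m + 1) div 2"
    unfolding S_def by (subst card_Un_disjoint) (auto simp: card_image E_def)
  \<comment> \<open>The path neighbors of an even vertex are odd, hence outside \<open>S\<close>,
    which leaves only its leaf; a leaf has just one neighbor anyway.\<close>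
  have "card {u \<in> S. (u, v) \<in> parcs ?G} \<le> 1" if "v \<in> S" for v
  proof (cases v)
    case (Inl i)
    then have "{u \<in> S. (u, v) \<in> parcs ?G} \<subseteq> {Inr i}"
      using that by (auto simp: S_def corona_K1_def path_graph_def dest!: E)
    then show ?thesis by (rule card_subset_singleton_le)
  next
    case (Inr i)
    then have "{u \<in> S. (u, v) \<in> parcs ?G} \<subseteq> {Inl i}"
      by (auto simp: corona_K1_def)
    then show ?thesis by (rule card_subset_singleton_le)
  qed
  moreover have "S \<subseteq> pverts ?G"
    by (auto simp: S_def corona_K1_def path_graph_def dest: E)
  ultimately have "two_independent ?G S" by (simp add: two_independent_def)
  then show ?thesis
    unfolding two_independence_number_def card[symmetric]
    using finite_two_independent_sizes[OF finite_pverts_corona_path]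
    by (intro Max_ge) auto
qed

text \<open>A color has its last column at \<open>k\<close> exactly when it lies in
  \<open>colors_from f k\<close> but not in \<open>colors_from f (Suc k)\<close>, so counting by
  last column becomes a recursion on \<open>k\<close>.\<close>

definition colors_from :: "(nat + nat \<rightharpoonup> nat) \<Rightarrow> nat \<Rightarrow> nat set" where
  "colors_from f k = {c. \<exists>i\<ge>k. f (Inl i) = Some c \<or> f (Inr i) = Some c}"

text \<open>Phrasing the new column through \<open>Some c\<close> makes an uncolored vertex
  contribute nothing.\<close>

lemma colors_from_Suc:
  "colors_from f k = colors_from f (Suc k) \<union> {c. Some c \<in> {f (Inl k), f (Inr k)}}"
  unfolding colors_from_def
  by (auto simp: Suc_le_eq) (metis le_eq_less_or_eq)+

lemma card_two_columns_le:
  assumes f: "sub_quorum_coloring (corona_K1 (path_graph m)) l f"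
  shows "card (colors_from f k) \<le> card (colors_from f (Suc (Suc k))) + 3"
proof -
  let ?N = "closed_nbhd (corona_K1 (path_graph m)) (Inl (Suc k))"
  let ?Q = "{f (Inl k), f (Inr k), f (Inl (Suc k)), f (Inr (Suc k))}"
  define C where "C = colors_from f (Suc (Suc k))"
  \<comment> \<open>\<open>X\<close> holds the colors whose last column is \<open>k\<close> or
    \<open>Suc k\<close>.\<close>
  define X where "X = {c. Some c \<in> ?Q} - C"
  have sub: "Some ` X \<subseteq> ?Q" by (auto simp: X_def)
  have "card X \<le> 3"
  proof (rule ccontr)
    assume "\<not> card X \<le> 3"
    then have X: "card (Some ` X) \<ge> 4" by (simp add: card_image)
    have Q4: "card ?Q \<le> 4" by (simp add: card_insert_if)
    \<comment> \<open>Four colors fill all of \<open>?Q\<close>: the four vertices are colored, with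
      distinct colors that never recur further right.\<close>
    have eq: "Some ` X = ?Q"
      using sub X Q4 by (intro card_seteq) auto
    then have "card ?Q = 4" using X Q4 by simp
    then have dist: "distinct [f (Inl k), f (Inr k), f (Inl (Suc k)), f (Inr (Suc k))]"
      by (intro card_distinct) simp
    have ex: "\<exists>c. y = Some c \<and> c \<notin> C" if "y \<in> ?Q" for y
      using that unfolding eq[symmetric] by (auto simp: X_def)
    obtain c where c: "f (Inl (Suc k)) = Some c" "c \<notin> C" using ex by blast
    have "f (Inl k) \<noteq> None" "f (Inr (Suc k)) \<noteq> None" using ex by blast+
    then have dom: "{Inl k, Inl (Suc k), Inr (Suc k)} \<subseteq> dom f" using c by auto
    \<comment> \<open>Being colored, these vertices exist, which yields \<open>Suc k < m\<close> and
      hence the adjacencies.\<close>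
    then have "{Inl k, Inl (Suc k), Inr (Suc k)} \<subseteq> pverts (corona_K1 (path_graph m))"
      using f unfolding sub_quorum_coloring_def by blast
    then have in_N: "{Inl k, Inl (Suc k), Inr (Suc k)} \<subseteq> ?N"
      by (auto simp: closed_nbhd_def corona_K1_def path_graph_def)
    \<comment> \<open>Only an inclusion: \<open>Inl (Suc (Suc k))\<close> is missing if column
      \<open>Suc k\<close> is the last one.\<close>
    have N: "?N \<subseteq> {Inl k, Inl (Suc k), Inr (Suc k), Inl (Suc (Suc k))}"
      by (auto simp: closed_nbhd_def corona_K1_def path_graph_def)
    have "card {Inl k, Inl (Suc k), Inr (Suc k)} \<le> card {u \<in> ?N. u \<in> dom f}"
      using in_N dom N by (intro card_mono) (auto intro: finite_subset)
    then have three: "3 \<le> card {u \<in> ?N. u \<in> dom f}" by simp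
    \<comment> \<open>The right-hand path neighbor is the only one not covered by
      \<open>dist\<close>; it cannot have color \<open>c\<close>, as \<open>c\<close> does not
      recur.\<close>
    have "f (Inl (Suc (Suc k))) \<noteq> Some c"
      using c(2) by (auto simp: C_def colors_from_def)
    then have "{u \<in> ?N. u \<in> dom f \<and> f u = f (Inl (Suc k))} \<subseteq> {Inl (Suc k)}"
      using N c(1) dist by auto
    then have "card {u \<in> ?N. u \<in> dom f \<and> f u = f (Inl (Suc k))} \<le> 1"
      by (rule card_subset_singleton_le)
    moreover have "card {u \<in> ?N. u \<in> dom f}
        \<le> 2 * card {u \<in> ?N. u \<in> dom f \<and> f u = f (Inl (Suc k))}"
      using f c(1) unfolding sub_quorum_coloring_def by blast
    ultimately show False using three by linarith
  qed
  moreover have "colors_from f k = C \<union> X"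
    unfolding C_def X_def colors_from_Suc[of f k] colors_from_Suc[of f "Suc k"] by auto
  ultimately show ?thesis
    using card_Un_le[of C X] by (simp add: C_def)
qed

text \<open>Here \<open>d\<close> counts the columns from \<open>k\<close> to the right end. Two
  more columns add at most three colors, and the bound grows by exactly three when \<open>d\<close>
  grows by two; a single column gives at most two.\<close>

lemma card_colors_from_le:
  assumes f: "sub_quorum_coloring (corona_K1 (path_graph m)) l f"
  shows "m = k + d \<Longrightarrow> card (colors_from f k) \<le> d + (d + 1) div 2"
proof (induction d arbitrary: k rule: induct_nat_012)
  have none: "f (Inl i) = None" "f (Inr i) = None" if "i \<ge> m" for i
    using f that by (auto simp: sub_quorum_coloring_def corona_K1_def path_graph_def dom_def)
  have empty: "colors_from f m = {}"
    by (simp add: colors_from_def none)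
  {
    case 0
    then show ?case using empty by simp
  next
    case 1
    have "Some ` {c. Some c \<in> {f (Inl k), f (Inr k)}} \<subseteq> {f (Inl k), f (Inr k)}" by auto
    then have "card (Some ` {c. Some c \<in> {f (Inl k), f (Inr k)}}) \<le> card {f (Inl k), f (Inr k)}"
      by (intro card_mono) auto
    also have "\<dots> \<le> 2" by (simp add: card_insert_if)
    finally show ?case
      using empty 1 colors_from_Suc[of f k] by (simp add: card_image)
  next
    case (ge2 d)
    then show ?case
      using card_two_columns_le[OF f, of k] ge2.IH(1)[of "Suc (Suc k)"] by simp
  }
qed

lemma sub_quorum_number_corona_path_le:
  "sub_quorum_number (corona_K1 (path_graph m)) \<le> m + (m + 1) div 2"
proof -
  have "l \<le> m + (m + 1) div 2" if f: "sub_quorum_coloring (corona_K1 (path_graph m)) l f" for l f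
  proof -
    \<comment> \<open>From column 0 on every vertex is seen, so all \<open>l\<close> colors are
      counted.\<close>
    have "colors_from f 0 = ran f"
      unfolding colors_from_def ran_def by (auto, metis sum.exhaust)
    then have "card (colors_from f 0) = l"
      using f by (simp add: sub_quorum_coloring_def)
    then show ?thesis using card_colors_from_le[OF f, of 0 m] by simp
  qed
  then show ?thesis
    unfolding sub_quorum_number_def
    using finite_sub_quorum_sizes[OF finite_pverts_corona_path] sub_quorum_sizes_nonempty
    by (subst Max_le_iff) auto
qed

theorem theorem16:
  fixes m :: nat
  assumes "m \<ge> 1"
  shows "sub_quorum_number (corona_K1 (path_graph m))
           = two_independence_number (corona_K1 (path_graph m))
       \<and> int (two_independence_number (corona_K1 (path_graph m)))
           = int m + \<lceil>real m / 2\<rceil>"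
proof -
  have "\<lceil>real m / 2\<rceil> = int ((m + 1) div 2)"
    by (cases "even m") (auto elim!: evenE oddE simp: ceiling_unique)
  \<comment> \<open>The three bounds close a cycle of inequalities, so both numbers equal
    \<open>m + (m + 1) div 2\<close>.\<close>
  then show ?thesis
    using two_independence_number_le_sub_quorum_number[OF finite_pverts_corona_path, of m]
      two_independence_number_corona_path_ge[of m] sub_quorum_number_corona_path_le[of m]
    by simp
qed

end
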